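(* Given a weighted graph $(G,w)$, we can expand its extended chromatic symmetric function into the power sum symmetric functions via $$X_{(G,w)}=\sum_{\pi \in L_G} \mu (\hat{0}, \pi)\, p_{\operatorname{type}(\pi, w)}.$$
   Context: Graphs are finite; loops and multiple edges are permitted. A weighted graph $(G,w)$ is a graph $G$ with a weight function $w:V(G)\to\mathbb{Z}^+$. A proper colouring of $G$ is a map $\kappa:V(G)\to\mathbb{Z}^+$ with $\kappa(u)\neq\kappa(v)$ whenever $u,v\in V(G)$ and $uv$ is an edge of $G$. The extended chromatic symmetric function of $(G,w)$, with vertices $v_1,\dots,v_N$, is $X_{(G,w)}=\sum_\kappa x_{\kappa(v_1)}^{w(v_1)}\cdots x_{\kappa(v_N)}^{w(v_N)}$, summed over all proper colourings $\kappa$ of $G$. A set partition $\pi=\{S_1,\dots,S_{\ell(\pi)}\}$ of $V(G)$ is connected if the restriction of $G$ to each block $S_i$ is connected. The lattice of contractions $L_G$ is the set of all connected set partitions of $V(G)$, partially ordered by refinement ($\sigma\le\pi$ if every block of $\sigma$ is contained in a block of $\pi$); $\hat 0$ is its unique minimal element, in which each vertex is in its own block; $\mu$ is the Möbius function of $L_G$. For $\pi\in L_G$, $\operatorname{type}(\pi,w)$ is the integer partition of $\sum_{v\in V(G)}w(v)$ whose parts are the total sums of the weights of each block of $\pi$. The power sum symmetric functions are $p_i=\sum_j x_j^i$ for $i\ge 1$ and $p_\lambda=\prod_{i} p_{\lambda_i}$ for an integer partition $\lambda=(\lambda_1,\lambda_2,\dots)$, the product being over the parts of $\lambda$.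
   Formalization: The graph is assumed to have no loops (multiple edges are allowed): a graph with a loop has no proper colouring, so its chromatic symmetric function is 0, while the right-hand side is nonzero, e.g. p_1 for a single vertex of weight 1 with a loop. *)

theory Defs
  imports
    "HOL-Library.FuncSet"
    "HOL-Library.Disjoint_Sets"
    "HOL-Library.Multiset"
    "HOL-Library.Poly_Mapping"
    "HOL-Library.Uprod"
begin

section \<open>Formal power series in countably many variables\<close>

text \<open>
  A power series is its family of coefficients, indexed by the monomials, i.e. by the exponent
  vectors of finite support. There is one variable for every natural number; the series below
  only involve those with a positive index.
\<close>

typedef 'a mps = "UNIV :: ((nat \<Rightarrow>\<^sub>0 nat) \<Rightarrow> 'a) set"
  morphisms mcoeff Abs_mps ..

setup_lifting type_definition_mps

lemma mps_eqI: "(\<And>m. mcoeff f m = mcoeff g m) \<Longrightarrow> f = g"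
  by transfer auto

definition splits :: "(nat \<Rightarrow>\<^sub>0 nat) \<Rightarrow> ((nat \<Rightarrow>\<^sub>0 nat) \<times> (nat \<Rightarrow>\<^sub>0 nat)) set"
  where "splits m = {(a, b). a + b = m}"

lemma finite_splits: "finite (splits m)"
proof -
  let ?K = "Poly_Mapping.keys m"
  let ?B = "\<Union>k\<in>?K. {..Poly_Mapping.lookup m k}"
  let ?F = "{f. \<forall>x. (x \<in> ?K \<longrightarrow> f x \<in> ?B) \<and> (x \<notin> ?K \<longrightarrow> f x = (0::nat))}"
  have fin: "finite ?F"
    by (rule finite_set_of_finite_funs) auto
  have lookup_in: "Poly_Mapping.lookup a \<in> ?F" if "a + b = m" for a b
  proof -
    have le: "Poly_Mapping.lookup a x \<le> Poly_Mapping.lookup m x" for x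
      unfolding that[symmetric] by (simp add: lookup_add)
    have "Poly_Mapping.lookup a x \<in> ?B" if "x \<in> ?K" for x
      using le[of x] that by blast
    moreover have "Poly_Mapping.lookup a x = 0" if "x \<notin> ?K" for x
      using le[of x] that by (simp add: in_keys_iff)
    ultimately show ?thesis by blast
  qed
  have "Poly_Mapping.lookup ` fst ` splits m \<subseteq> ?F"
  proof (intro subsetI, elim imageE)
    fix f p q
    assume "f = Poly_Mapping.lookup q" "q = fst p" "p \<in> splits m"
    then show "f \<in> ?F"
      using lookup_in[of "fst p" "snd p"] by (simp add: splits_def case_prod_beta)
  qed
  then have "finite (Poly_Mapping.lookup ` fst ` splits m)"
    using fin by (rule finite_subset)
  then have fin1: "finite (fst ` splits m)"
    by (rule finite_imageD) (simp add: inj_on_def lookup_inject)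
  have "inj_on fst (splits m)"
    by (auto simp: inj_on_def splits_def)
  then show ?thesis
    using fin1 finite_imageD by blast
qed

instantiation mps :: (comm_ring_1) comm_ring_1
begin

lift_definition zero_mps :: "'a mps" is "\<lambda>_. 0" .
lift_definition one_mps :: "'a mps" is "\<lambda>m. if m = 0 then 1 else 0" .
lift_definition plus_mps :: "'a mps \<Rightarrow> 'a mps \<Rightarrow> 'a mps" is "\<lambda>f g m. f m + g m" .
lift_definition minus_mps :: "'a mps \<Rightarrow> 'a mps \<Rightarrow> 'a mps" is "\<lambda>f g m. f m - g m" .
lift_definition uminus_mps :: "'a mps \<Rightarrow> 'a mps" is "\<lambda>f m. - f m" .
lift_definition times_mps :: "'a mps \<Rightarrow> 'a mps \<Rightarrow> 'a mps"
  is "\<lambda>f g m. \<Sum>(a, b)\<in>splits m. f a * g b" .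

instance
proof
  fix f g h :: "'a mps"
  show "f * g * h = f * (g * h)"
  proof (transfer, rule ext)
    fix f g h :: "(nat \<Rightarrow>\<^sub>0 nat) \<Rightarrow> 'a" and m
    have "(\<Sum>(a, b)\<in>splits m. (\<Sum>(c, d)\<in>splits a. f c * g d) * h b)
        = (\<Sum>p\<in>splits m. \<Sum>q\<in>splits (fst p). f (fst q) * g (snd q) * h (snd p))"
      by (simp add: sum_distrib_right case_prod_beta)
    also have "\<dots> = (\<Sum>(p, q)\<in>(SIGMA p:splits m. splits (fst p)). f (fst q) * g (snd q) * h (snd p))"
      by (simp add: sum.Sigma finite_splits)
    also have "\<dots> = (\<Sum>(p, q)\<in>(SIGMA p:splits m. splits (snd p)). f (fst p) * (g (fst q) * h (snd q)))"
      by (rule sum.reindex_bij_witness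
          [of _ "\<lambda>(p, q). ((fst p + fst q, snd q), (fst p, fst q))"
                "\<lambda>(p, q). ((fst q, snd q + snd p), (snd q, snd p))"])
         (auto simp: splits_def algebra_simps)
    also have "\<dots> = (\<Sum>p\<in>splits m. \<Sum>q\<in>splits (snd p). f (fst p) * (g (fst q) * h (snd q)))"
      by (simp add: sum.Sigma finite_splits)
    also have "\<dots> = (\<Sum>(a, b)\<in>splits m. f a * (\<Sum>(c, d)\<in>splits b. g c * h d))"
      by (simp add: sum_distrib_left case_prod_beta)
    finally show "(\<Sum>(a, b)\<in>splits m. (\<Sum>(c, d)\<in>splits a. f c * g d) * h b)
        = (\<Sum>(a, b)\<in>splits m. f a * (\<Sum>(c, d)\<in>splits b. g c * h d))" .
  qed
  show "f * g = g * f"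
  proof (transfer, rule ext)
    fix f g :: "(nat \<Rightarrow>\<^sub>0 nat) \<Rightarrow> 'a" and m
    show "(\<Sum>(a, b)\<in>splits m. f a * g b) = (\<Sum>(a, b)\<in>splits m. g a * f b)"
      by (rule sum.reindex_bij_witness[of _ prod.swap prod.swap])
         (auto simp: splits_def algebra_simps)
  qed
  show "1 * f = f"
  proof (transfer, rule ext)
    fix f :: "(nat \<Rightarrow>\<^sub>0 nat) \<Rightarrow> 'a" and m
    have "(\<Sum>(a, b)\<in>splits m. (if a = 0 then 1 else 0) * f b)
        = (\<Sum>(a, b)\<in>{(0 :: nat \<Rightarrow>\<^sub>0 nat, m)}. (if a = 0 then 1 else 0) * f b)"
      by (rule sum.mono_neutral_right) (simp add: finite_splits, auto simp: splits_def split: if_splits)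
    then show "(\<Sum>(a, b)\<in>splits m. (if a = 0 then 1 else 0) * f b) = f m"
      by simp
  qed
  show "(f + g) * h = f * h + g * h"
    by transfer (auto simp: fun_eq_iff algebra_simps sum.distrib case_prod_beta)
  show "f + g + h = f + (g + h)" "f + g = g + f" "0 + f = f" "- f + f = 0" "f - g = f + - g"
    by (transfer, auto simp: fun_eq_iff)+
  show "(0 :: 'a mps) \<noteq> 1"
    by transfer (auto simp: fun_eq_iff)
qed

end

lift_definition mps_var :: "nat \<Rightarrow> 'a :: comm_ring_1 mps"
  is "\<lambda>i m. if m = Poly_Mapping.single i 1 then 1 else 0" .

text \<open>
  The sum of a possibly infinite family of power series, taken coefficientwise. It is meaningful
  for summable families, in which every monomial occurs in only finitely many members.
\<close>

definition mps_summable :: "('i \<Rightarrow> 'a :: comm_ring_1 mps) \<Rightarrow> 'i set \<Rightarrow> bool"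
  where "mps_summable f I \<longleftrightarrow> (\<forall>m. finite {i \<in> I. mcoeff (f i) m \<noteq> 0})"

lift_definition formal_sum :: "('i \<Rightarrow> 'a :: comm_ring_1 mps) \<Rightarrow> 'i set \<Rightarrow> 'a mps"
  is "\<lambda>f I m. \<Sum>i | i \<in> I \<and> f i m \<noteq> 0. f i m" .

section \<open>Power sum symmetric functions\<close>

definition power_sum :: "nat \<Rightarrow> int mps"
  where "power_sum i = formal_sum (\<lambda>j. mps_var j ^ i) {1..}"

text \<open>Integer partitions are represented by the multiset of their parts.\<close>

definition power_sums :: "nat multiset \<Rightarrow> int mps"
  where "power_sums lam = (\<Prod>i\<in>#lam. power_sum i)"

section \<open>Graphs and the extended chromatic symmetric function\<close>

text \<open>Edges are unordered pairs with multiplicity, so loops and multiple edges are possible.\<close>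

record 'v graph =
  verts :: "'v set"
  edges :: "'v uprod multiset"

definition finite_graph :: "'v graph \<Rightarrow> bool"
  where "finite_graph G \<longleftrightarrow> finite (verts G) \<and> (\<forall>e\<in>#edges G. set_uprod e \<subseteq> verts G)"

definition loopless :: "'v graph \<Rightarrow> bool"
  where "loopless G \<longleftrightarrow> (\<forall>v. Upair v v \<notin># edges G)"

definition weighted_graph :: "'v graph \<Rightarrow> ('v \<Rightarrow> nat) \<Rightarrow> bool"
  where "weighted_graph G w \<longleftrightarrow> finite_graph G \<and> (\<forall>v\<in>verts G. 0 < w v)"

text \<open>Colourings are extensional, so that they are determined by their values on the vertices.\<close>

definition proper_colourings :: "'v graph \<Rightarrow> ('v \<Rightarrow> nat) set"
  where "proper_colourings G =
    {\<kappa> \<in> verts G \<rightarrow>\<^sub>E {1..}.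
      \<forall>u\<in>verts G. \<forall>v\<in>verts G. Upair u v \<in># edges G \<longrightarrow> \<kappa> u \<noteq> \<kappa> v}"

definition chromatic_function :: "'v graph \<Rightarrow> ('v \<Rightarrow> nat) \<Rightarrow> int mps"
  where "chromatic_function G w =
    formal_sum (\<lambda>\<kappa>. \<Prod>v\<in>verts G. mps_var (\<kappa> v) ^ w v) (proper_colourings G)"

section \<open>The lattice of contractions\<close>

definition restriction :: "'v graph \<Rightarrow> 'v set \<Rightarrow> 'v graph"
  where "restriction G S =
    \<lparr>verts = verts G \<inter> S, edges = filter_mset (\<lambda>e. set_uprod e \<subseteq> S) (edges G)\<rparr>"

definition connected_graph :: "'v graph \<Rightarrow> bool"
  where "connected_graph G \<longleftrightarrow>
    (\<forall>u\<in>verts G. \<forall>v\<in>verts G. (u, v) \<in> {(a, b). Upair a b \<in># edges G}\<^sup>*)"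

definition contractions :: "'v graph \<Rightarrow> 'v set set set"
  where "contractions G =
    {\<pi>. partition_on (verts G) \<pi> \<and> (\<forall>S\<in>\<pi>. connected_graph (restriction G S))}"

definition contraction_order :: "'v graph \<Rightarrow> ('v set set \<times> 'v set set) set"
  where "contraction_order G =
    {(\<sigma>, \<pi>). \<sigma> \<in> contractions G \<and> \<pi> \<in> contractions G \<and> refines (verts G) \<sigma> \<pi>}"

definition bottom_contraction :: "'v graph \<Rightarrow> 'v set set"
  where "bottom_contraction G = (\<lambda>v. {v}) ` verts G"

definition type_of :: "('v \<Rightarrow> nat) \<Rightarrow> 'v set set \<Rightarrow> nat multiset"
  where "type_of w \<pi> = image_mset (\<lambda>S. \<Sum>v\<in>S. w v) (mset_set \<pi>)"

section \<open>The Moebius function of a finite poset\<close>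

text \<open>
  A finite poset is represented by its order relation. The guard is only there to make the
  recursion terminate; the contraction order satisfies it (see below).
\<close>

function mobius :: "('a \<times> 'a) set \<Rightarrow> 'a \<Rightarrow> 'a \<Rightarrow> int" where
  "mobius r x y =
    (if finite r \<and> Partial_order r \<and> (x, y) \<in> r
     then if x = y then 1
       else - (\<Sum>z\<in>{z. (x, z) \<in> r \<and> (z, y) \<in> r \<and> z \<noteq> y}. mobius r x z)
     else 0)"
  by auto
termination
proof (relation "measure (\<lambda>(r, x, y). card {z. (x, z) \<in> r \<and> (z, y) \<in> r})")
  fix r :: "('a \<times> 'a) set" and x y z
  assume r: "finite r \<and> Partial_order r \<and> (x, y) \<in> r"
    and z: "z \<in> {z. (x, z) \<in> r \<and> (z, y) \<in> r \<and> z \<noteq> y}"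
  have tr: "trans r" and an: "antisym r" and re: "refl_on (Field r) r"
    using r by (auto dest: partial_order_onD)
  have "{u. (x, u) \<in> r \<and> (u, z) \<in> r} \<subseteq> {u. (x, u) \<in> r \<and> (u, y) \<in> r}"
    using z tr by (auto dest: transD)
  moreover have "y \<in> {u. (x, u) \<in> r \<and> (u, y) \<in> r}"
    using r re by (auto simp: refl_on_def Field_def)
  moreover have "y \<notin> {u. (x, u) \<in> r \<and> (u, z) \<in> r}"
    using z an by (auto dest: antisymD)
  ultimately have "{u. (x, u) \<in> r \<and> (u, z) \<in> r} \<subset> {u. (x, u) \<in> r \<and> (u, y) \<in> r}"
    by blast
  moreover have "finite {u. (x, u) \<in> r \<and> (u, y) \<in> r}"
    by (rule finite_subset[of _ "Range r"]) (use r in \<open>auto intro: finite_Range\<close>)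
  ultimately show "((r, x, z), (r, x, y)) \<in> measure (\<lambda>(r, x, y). card {z. (x, z) \<in> r \<and> (z, y) \<in> r})"
    by (simp add: psubset_card_mono)
qed simp

declare mobius.simps [simp del]

section \<open>Well-definedness\<close>

lemma finite_contractions:
  assumes "finite_graph G"
  shows "finite (contractions G)"
proof (rule finite_subset)
  show "contractions G \<subseteq> Pow (Pow (verts G))"
    by (auto simp: contractions_def partition_on_def)
qed (use assms in \<open>simp add: finite_graph_def\<close>)

lemma refines_trans':
  assumes "refines A P Q" "refines A Q R"
  shows "refines A P R"
  using assms unfolding refines_def by (meson subset_trans)

lemma Field_contraction_order: "Field (contraction_order G) = contractions G"
  by (auto simp: Field_def contraction_order_def contractions_def intro: refines_refl)

lemma contraction_order_finite_poset:
  assumes "finite_graph G"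
  shows "finite (contraction_order G)" "Partial_order (contraction_order G)"
proof -
  have "contraction_order G \<subseteq> contractions G \<times> contractions G"
    by (auto simp: contraction_order_def)
  then show "finite (contraction_order G)"
    using finite_contractions[OF assms] by (meson finite_SigmaI finite_subset)
  show "Partial_order (contraction_order G)"
    unfolding Field_contraction_order partial_order_on_def preorder_on_def
  proof (intro conjI)
    show "contraction_order G \<subseteq> contractions G \<times> contractions G"
      by (auto simp: contraction_order_def)
    show "refl_on (contractions G) (contraction_order G)"
      by (auto simp: contraction_order_def contractions_def refl_on_def intro: refines_refl)
    show "trans (contraction_order G)"
      by (auto simp: contraction_order_def intro!: transI intro: refines_trans')
    show "antisym (contraction_order G)"
      unfolding contraction_order_def by (rule antisymI) (auto dest: refines_asym)
  qed
qed

lemma bottom_contraction_in: "bottom_contraction G \<in> contractions G"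
  unfolding contractions_def bottom_contraction_def
  by (auto simp: partition_on_def disjoint_def connected_graph_def restriction_def)

lemma bottom_contraction_least:
  assumes "\<pi> \<in> contractions G"
  shows "(bottom_contraction G, \<pi>) \<in> contraction_order G"
  using assms bottom_contraction_in[of G]
  unfolding contraction_order_def refines_def contractions_def bottom_contraction_def
  by (auto simp: partition_on_def)

lemma mps_var_power: "mps_var i ^ n = Abs_mps (\<lambda>m. if m = Poly_Mapping.single i n then 1 else 0)"
proof (induction n)
  case 0
  show ?case by (simp add: one_mps_def)
next
  case (Suc n)
  show ?case
  proof (rule mps_eqI)
    fix m
    have "mcoeff (mps_var i * mps_var i ^ n) m = (\<Sum>(a, b)\<in>splits m. (if a = Poly_Mapping.single i 1 then 1 else 0) *
        (if b = Poly_Mapping.single i n then 1 else (0 :: 'a)))"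
      by (simp add: Suc times_mps.rep_eq mps_var.rep_eq Abs_mps_inverse)
    also have "\<dots> = (\<Sum>p\<in>splits m \<inter> {(Poly_Mapping.single i 1, Poly_Mapping.single i n)}. 1)"
      by (rule sum.mono_neutral_cong_right) (auto simp: finite_splits split: if_splits)
    also have "\<dots> = (if m = Poly_Mapping.single i (Suc n) then 1 else 0)"
      by (auto simp: splits_def single_add[symmetric])
    finally show "mcoeff (mps_var i ^ Suc n :: 'a mps) m =
        mcoeff (Abs_mps (\<lambda>m. if m = Poly_Mapping.single i (Suc n) then 1 else 0)) m"
      by (simp add: Abs_mps_inverse)
  qed
qed

lemma power_sum_summable:
  assumes "0 < i"
  shows "mps_summable (\<lambda>j. mps_var j ^ i :: int mps) {1..}"
  unfolding mps_summable_def
proof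
  fix m :: "nat \<Rightarrow>\<^sub>0 nat"
  have "{j \<in> {1..}. mcoeff (mps_var j ^ i :: int mps) m \<noteq> 0} \<subseteq> Poly_Mapping.keys m"
    using assms by (auto simp: mps_var_power Abs_mps_inverse split: if_splits)
  then show "finite {j \<in> {1..}. mcoeff (mps_var j ^ i :: int mps) m \<noteq> 0}"
    by (rule finite_subset) simp
qed

lemma chromatic_function_summable:
  assumes "weighted_graph G w"
  shows "mps_summable (\<lambda>\<kappa>. \<Prod>v\<in>verts G. mps_var (\<kappa> v) ^ w v :: int mps) (proper_colourings G)"
  unfolding mps_summable_def
proof
  fix m :: "nat \<Rightarrow>\<^sub>0 nat"
  let ?c = "\<lambda>\<kappa> A. mcoeff (\<Prod>v\<in>A. mps_var (\<kappa> v) ^ w v :: int mps)"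
  have fin: "finite (verts G)" and pos: "\<And>v. v \<in> verts G \<Longrightarrow> 0 < w v"
    using assms by (auto simp: weighted_graph_def finite_graph_def)
  have keys: "\<kappa> ` A \<subseteq> Poly_Mapping.keys n"
    if "finite A" "A \<subseteq> verts G" "?c \<kappa> A n \<noteq> 0" for \<kappa> A n
    using that
  proof (induction A arbitrary: n rule: finite_induct)
    case (insert v A)
    from insert.prems insert.hyps obtain a b where ab: "(a, b) \<in> splits n"
      "mcoeff (mps_var (\<kappa> v) ^ w v :: int mps) a * ?c \<kappa> A b \<noteq> 0"
      by (auto simp: times_mps.rep_eq elim!: sum.not_neutral_contains_not_neutral)
    then have "a = Poly_Mapping.single (\<kappa> v) (w v)" "\<kappa> ` A \<subseteq> Poly_Mapping.keys b"
      using insert by (auto simp: mps_var_power Abs_mps_inverse split: if_splits)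
    moreover have "Poly_Mapping.keys a \<subseteq> Poly_Mapping.keys n" "Poly_Mapping.keys b \<subseteq> Poly_Mapping.keys n"
      using ab by (auto simp: splits_def in_keys_iff lookup_add)
    moreover have "0 < w v"
      using insert.prems pos by auto
    ultimately show ?case by auto
  qed simp
  have "{\<kappa> \<in> proper_colourings G. ?c \<kappa> (verts G) m \<noteq> 0} \<subseteq> verts G \<rightarrow>\<^sub>E Poly_Mapping.keys m"
  proof (rule subsetI)
    fix \<kappa>
    assume \<kappa>: "\<kappa> \<in> {\<kappa> \<in> proper_colourings G. ?c \<kappa> (verts G) m \<noteq> 0}"
    then have "\<kappa> ` verts G \<subseteq> Poly_Mapping.keys m"
      using keys[OF fin subset_refl] by blast
    moreover have "\<kappa> \<in> extensional (verts G)"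
      using \<kappa> by (simp add: proper_colourings_def PiE_def)
    ultimately show "\<kappa> \<in> verts G \<rightarrow>\<^sub>E Poly_Mapping.keys m"
      by (auto simp: PiE_def)
  qed
  then show "finite {\<kappa> \<in> proper_colourings G. ?c \<kappa> (verts G) m \<noteq> 0}"
    by (rule finite_subset) (simp add: fin finite_PiE)
qed

text \<open>
  A loop rules out all proper colourings, whereas the lattice of contractions does not see loops.
  This is why the expansion into power sums needs a loopless graph.
\<close>

lemma chromatic_function_loop:
  assumes "finite_graph G" "\<not> loopless G"
  shows "chromatic_function G w = 0"
proof -
  obtain v where v: "Upair v v \<in># edges G"
    using assms(2) by (auto simp: loopless_def)
  then have "v \<in> verts G"
    using assms(1) by (force simp: finite_graph_def)
  with v have "proper_colourings G = {}"
    by (auto simp: proper_colourings_def)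
  then show ?thesis
    by (intro mps_eqI) (simp add: chromatic_function_def formal_sum.rep_eq zero_mps.rep_eq)
qed

end

theory Submission
  imports Defs
begin

text \<open>
  For a colouring \<open>\<kappa>\<close> of the vertices, let \<open>\<pi>\<^sub>\<kappa>\<close> be the partition into monochromatic components.
  A contraction \<open>\<sigma>\<close> has monochromatic blocks iff \<open>\<sigma> \<le> \<pi>\<^sub>\<kappa>\<close>, and the power sum of type \<open>\<sigma>\<close>
  enumerates exactly the colourings with that property. After exchanging the two summations, the
  monomial of \<open>\<kappa>\<close> occurs on the right-hand side with the coefficient
  \<open>\<Sum>\<sigma> \<le> \<pi>\<^sub>\<kappa>. \<mu>(0, \<sigma>)\<close>, which is 1 if \<open>\<pi>\<^sub>\<kappa>\<close> is the bottom element, i.e. if \<open>\<kappa>\<close> is proper, and 0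
  otherwise.
\<close>

section \<open>Coefficients\<close>

lemma mcoeff_sum: "mcoeff (\<Sum>i\<in>A. f i) m = (\<Sum>i\<in>A. mcoeff (f i) m)"
  by (induction A rule: infinite_finite_induct) (simp_all add: zero_mps.rep_eq plus_mps.rep_eq)

text \<open>In the ring of series \<open>of_int c\<close> is reached from 0 by adding or subtracting
  1, and each such step adds or subtracts one copy of \<open>mcoeff f m\<close>.\<close>

lemma mcoeff_of_int_mult: "mcoeff (of_int c * f) m = of_int c * mcoeff f m"
proof (induction c rule: int_induct[where k = 0])
  case base
  show ?case by (simp add: zero_mps.rep_eq)
next
  case (step1 i)
  then show ?case by (simp add: algebra_simps plus_mps.rep_eq)
next
  case (step2 i)
  then show ?case by (simp add: algebra_simps minus_mps.rep_eq)
qed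

lemma mcoeff_var_power:
  "mcoeff (mps_var i ^ n) m = (if m = Poly_Mapping.single i n then 1 else 0)"
  by (simp add: mps_var_power Abs_mps_inverse)

text \<open>The exponent vector of the product of the \<open>mps_var (f i) ^ W i\<close>. The index
  type is generic because two kinds of objects get coloured: vertices with weights \<open>w\<close>,
  and blocks with weights \<open>sum w\<close>.\<close>

definition monomial_of :: "('i \<Rightarrow> nat) \<Rightarrow> 'i set \<Rightarrow> ('i \<Rightarrow> nat) \<Rightarrow> (nat \<Rightarrow>\<^sub>0 nat)"
  where "monomial_of W A f = (\<Sum>i\<in>A. Poly_Mapping.single (f i) (W i))"

definition colourings_with :: "('i \<Rightarrow> nat) \<Rightarrow> 'i set \<Rightarrow> (nat \<Rightarrow>\<^sub>0 nat) \<Rightarrow> ('i \<Rightarrow> nat) set"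
  where "colourings_with W A m = {f \<in> A \<rightarrow>\<^sub>E {1..}. monomial_of W A f = m}"

lemma mcoeff_prod_var_power:
  assumes "finite A"
  shows "mcoeff (\<Prod>i\<in>A. mps_var (f i) ^ W i :: 'r :: comm_ring_1 mps) m =
    (if monomial_of W A f = m then 1 else 0)"
  using assms
proof (induction A arbitrary: m rule: finite_induct)
  case empty
  show ?case by (auto simp: one_mps.rep_eq monomial_of_def)
next
  case (insert i A)
  have "mcoeff (\<Prod>i\<in>insert i A. mps_var (f i) ^ W i :: 'r mps) m =
      (\<Sum>(a, b)\<in>splits m. (if a = Poly_Mapping.single (f i) (W i) then 1 else 0) *
        (if monomial_of W A f = b then 1 else 0))"
    using insert by (simp add: times_mps.rep_eq mcoeff_var_power)
  \<comment> \<open>Both factors are single monomials, so only one pair can contribute; it lies in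
    \<open>splits m\<close> exactly when the two exponent vectors add up to
    \<open>m\<close>.\<close>
  also have "\<dots> = (\<Sum>p\<in>splits m \<inter> {(Poly_Mapping.single (f i) (W i), monomial_of W A f)}. 1)"
    by (rule sum.mono_neutral_cong_right) (auto simp: finite_splits split: if_splits)
  also have "\<dots> = (if monomial_of W (insert i A) f = m then 1 else 0)"
    using insert.hyps by (auto simp: splits_def monomial_of_def)
  finally show ?case .
qed

text \<open>Since \<open>W i\<close> is positive, the colour of \<open>i\<close> has a positive
  exponent in the monomial, and the other indices can only increase it. All colours therefore come
  from the finite support of \<open>m\<close>.\<close>

lemma finite_colourings_with:
  assumes "finite A" "\<And>i. i \<in> A \<Longrightarrow> 0 < W i"
  shows "finite (colourings_with W A m)"
proof (rule finite_subset)
  show "colourings_with W A m \<subseteq> A \<rightarrow>\<^sub>E Poly_Mapping.keys m"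
  proof (rule subsetI)
    fix f assume f: "f \<in> colourings_with W A m"
    have "f i \<in> Poly_Mapping.keys m" if "i \<in> A" for i
    proof -
      have "0 < Poly_Mapping.lookup (Poly_Mapping.single (f i) (W i)) (f i)"
        using assms(2)[OF that] by simp
      also have "\<dots> \<le> (\<Sum>j\<in>A. Poly_Mapping.lookup (Poly_Mapping.single (f j) (W j)) (f i))"
        using assms(1) that by (intro member_le_sum) auto
      also have "\<dots> = Poly_Mapping.lookup m (f i)"
        using f by (auto simp: colourings_with_def monomial_of_def lookup_sum)
      finally show ?thesis by (simp add: in_keys_iff)
    qed
    with f show "f \<in> A \<rightarrow>\<^sub>E Poly_Mapping.keys m"
      by (auto simp: colourings_with_def)
  qed
qed (use assms in \<open>simp add: finite_PiE\<close>)

lemma mcoeff_power_sum: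
  assumes "0 < i"
  shows "mcoeff (power_sum i) m = int (card {j \<in> {1..}. Poly_Mapping.single j i = m})"
proof -
  have "mcoeff (power_sum i) m = (\<Sum>j | j \<in> {1..} \<and> Poly_Mapping.single j i = m. 1)"
    unfolding power_sum_def formal_sum.rep_eq
    by (rule sum.cong) (auto simp: mcoeff_var_power)
  then show ?thesis by simp
qed

lemma finite_single_eq:
  fixes i :: nat
  assumes "0 < i"
  shows "finite {j \<in> {1..}. Poly_Mapping.single j i = m}"
  by (rule finite_subset[of _ "Poly_Mapping.keys m"]) (use assms in \<open>auto simp: in_keys_iff\<close>)

text \<open>Expanding the product picks one variable from each factor. The index of the variable
  picked from \<open>power_sum (W i)\<close> is read as the colour of \<open>i\<close>, and every
  pick contributes 1 to the coefficient of its monomial.\<close>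

lemma mcoeff_prod_power_sum:
  assumes "finite A" "\<And>i. i \<in> A \<Longrightarrow> 0 < W i"
  shows "mcoeff (\<Prod>i\<in>A. power_sum (W i)) m = int (card (colourings_with W A m))"
  using assms
proof (induction A arbitrary: m rule: finite_induct)
  case empty
  have "colourings_with W {} m = (if m = 0 then {\<lambda>_. undefined} else {})"
    by (auto simp: colourings_with_def monomial_of_def)
  then show ?case by (simp add: one_mps.rep_eq)
next
  case (insert i A)
  define J where "J a = {j \<in> {1..}. Poly_Mapping.single j (W i) = a}" for a :: "nat \<Rightarrow>\<^sub>0 nat"
  let ?S = "SIGMA p:splits m. J (fst p) \<times> colourings_with W A (snd p)"
  have finA: "finite (colourings_with W A b)" and finJ: "finite (J a)" for a b
    using insert finite_colourings_with[of A W b] finite_single_eq[of "W i" a] by (auto simp: J_def)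
  have upd: "monomial_of W (insert i A) g = Poly_Mapping.single (g i) (W i) + monomial_of W A g" for g
    using insert.hyps by (simp add: monomial_of_def)
  have cong: "monomial_of W A (g(i := x)) = monomial_of W A g" for g x
    using insert.hyps by (auto simp: monomial_of_def intro!: sum.cong)
  have "mcoeff (\<Prod>i\<in>insert i A. power_sum (W i)) m =
      (\<Sum>p\<in>splits m. int (card (J (fst p))) * int (card (colourings_with W A (snd p))))"
    using insert by (simp add: times_mps.rep_eq mcoeff_power_sum case_prod_beta J_def)
  also have "\<dots> = int (card ?S)"
    using finA finJ by (simp add: card_SigmaI finite_splits card_cartesian_product)
  \<comment> \<open>An element of \<open>?S\<close> is a splitting of \<open>m\<close>, a colour for
    \<open>i\<close> and a colouring of \<open>A\<close> that realise its two halves. The splitting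
    can be recovered from the combined colouring, and resetting \<open>i\<close> to
    \<open>undefined\<close> makes the rest extensional on \<open>A\<close> again.\<close>
  also have "card ?S = card (colourings_with W (insert i A) m)"
  proof (rule bij_betw_same_card, rule bij_betwI)
    show "(\<lambda>(p, j, f). f(i := j)) \<in> ?S \<rightarrow> colourings_with W (insert i A) m"
      using insert.hyps
      by (auto simp: J_def colourings_with_def splits_def upd cong PiE_iff extensional_def
          split: if_splits)
    show "(\<lambda>g. ((Poly_Mapping.single (g i) (W i), monomial_of W A g), g i, g(i := undefined)))
        \<in> colourings_with W (insert i A) m \<rightarrow> ?S"
      using insert.hyps
      by (auto simp: J_def colourings_with_def splits_def upd cong PiE_def extensional_def)
  next
    fix x assume "x \<in> ?S"
    then show "(\<lambda>g. ((Poly_Mapping.single (g i) (W i), monomial_of W A g), g i, g(i := undefined)))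
        ((\<lambda>(p, j, f). f(i := j)) x) = x"
      using insert.hyps
      by (auto simp: J_def colourings_with_def cong PiE_def extensional_def fun_eq_iff)
  qed auto
  finally show ?case .
qed

section \<open>Power sums of a partition\<close>

definition constant_on_blocks :: "'v set set \<Rightarrow> ('v \<Rightarrow> 'c) \<Rightarrow> bool"
  where "constant_on_blocks P f \<longleftrightarrow> (\<forall>S\<in>P. \<forall>u\<in>S. \<forall>v\<in>S. f u = f v)"

text \<open>A colouring that is constant on blocks amounts to a colouring of the blocks themselves.
  The monomial is preserved because a block of colour \<open>c\<close> contributes its total weight
  to the exponent of the variable \<open>c\<close>.\<close>

lemma card_colourings_of_blocks:
  assumes P: "partition_on V P" and fin: "finite V"
  shows "card (colourings_with (sum w) P m) = card {f \<in> colourings_with w V m. constant_on_blocks P f}"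
proof -
  define blk where "blk v = (THE S. S \<in> P \<and> v \<in> S)" for v
  have ex: "\<exists>!S. S \<in> P \<and> v \<in> S" if "v \<in> V" for v
    using P that by (auto simp: partition_on_def disjoint_def)
  have blk: "blk v \<in> P" "v \<in> blk v" if "v \<in> V" for v
    using theI'[OF ex[OF that]] by (auto simp: blk_def)
  have inV: "v \<in> V" if "v \<in> S" "S \<in> P" for v S
    using that P by (auto simp: partition_on_def)
  have blkI: "blk v = S" if "v \<in> S" "S \<in> P" for v S
    using ex[OF inV[OF that]] blk[OF inV[OF that]] that by blast
  have rep: "(SOME v. v \<in> S) \<in> S" if "S \<in> P" for S
    using that P by (metis partition_on_def ex_in_conv someI_ex)
  \<comment> \<open>Within a block all vertices have the colour of a representative, so additivity
    of \<open>Poly_Mapping.single\<close> in the exponent merges their contributions.\<close>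
  have mono: "monomial_of w V f = monomial_of (sum w) P (\<lambda>S. f (SOME v. v \<in> S))"
    if f: "constant_on_blocks P f" for f :: "_ \<Rightarrow> nat"
  proof -
    have "monomial_of w V f = (\<Sum>S\<in>P. \<Sum>v\<in>S. Poly_Mapping.single (f v) (w v))"
      unfolding monomial_of_def partition_onD1[OF P]
      using P fin by (subst sum.Union_disjoint) (auto simp: partition_on_def disjoint_def
          intro: finite_subset[OF Union_upper])
    also have "\<dots> = (\<Sum>S\<in>P. \<Sum>v\<in>S. Poly_Mapping.single (f (SOME v. v \<in> S)) (w v))"
      using f rep by (intro sum.cong refl) (metis constant_on_blocks_def)
    also have "\<dots> = monomial_of (sum w) P (\<lambda>S. f (SOME v. v \<in> S))"
      unfolding monomial_of_def
      by (intro sum.cong refl, induct_tac x rule: infinite_finite_induct) (simp_all add: single_add)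
    finally show ?thesis .
  qed
  \<comment> \<open>\<open>?F\<close> gives a block the colour of its chosen representative,
    \<open>?G\<close> gives a vertex the colour of its block. The restrictions keep both results
    extensional.\<close>
  let ?F = "\<lambda>f. restrict (\<lambda>S. f (SOME v. v \<in> S)) P"
  let ?G = "\<lambda>g. restrict (\<lambda>v. g (blk v)) V"
  have Gconst: "constant_on_blocks P (?G g)" for g :: "_ \<Rightarrow> nat"
    by (auto simp: constant_on_blocks_def inV blkI)
  have FG: "?F (?G g) = g" if "g \<in> P \<rightarrow>\<^sub>E {1..}" for g :: "_ \<Rightarrow> nat"
    using that by (auto simp: fun_eq_iff PiE_def extensional_def rep inV[OF rep] blkI[OF rep])
  have "bij_betw ?G (colourings_with (sum w) P m) {f \<in> colourings_with w V m. constant_on_blocks P f}"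
  proof (rule bij_betwI[where g = ?F])
    show "?G \<in> colourings_with (sum w) P m \<rightarrow> {f \<in> colourings_with w V m. constant_on_blocks P f}"
    proof (rule funcsetI)
      fix g assume g: "g \<in> colourings_with (sum w) P m"
      then have "g \<in> P \<rightarrow>\<^sub>E {1..}" by (simp add: colourings_with_def)
      have "monomial_of w V (?G g) = monomial_of (sum w) P (?F (?G g))"
        unfolding mono[OF Gconst]
        by (simp add: monomial_of_def)
      also have "\<dots> = m"
        unfolding FG[OF \<open>g \<in> P \<rightarrow>\<^sub>E {1..}\<close>] using g by (simp add: colourings_with_def)
      finally show "?G g \<in> {f \<in> colourings_with w V m. constant_on_blocks P f}"
        using Gconst \<open>g \<in> P \<rightarrow>\<^sub>E {1..}\<close> blk by (auto simp: colourings_with_def)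
    qed
    show "?F \<in> {f \<in> colourings_with w V m. constant_on_blocks P f} \<rightarrow> colourings_with (sum w) P m"
    proof (rule funcsetI)
      fix f assume f: "f \<in> {f \<in> colourings_with w V m. constant_on_blocks P f}"
      then have "monomial_of (sum w) P (?F f) = m"
        using mono[of f] by (simp add: colourings_with_def monomial_of_def)
      moreover have "?F f \<in> P \<rightarrow>\<^sub>E {1..}"
        using f rep inV by (auto simp: colourings_with_def)
      ultimately show "?F f \<in> colourings_with (sum w) P m"
        by (simp add: colourings_with_def)
    qed
  next
    fix g assume "g \<in> colourings_with (sum w) P m"
    then show "?F (?G g) = g"
      using FG by (simp add: colourings_with_def)
  next
    fix f assume f: "f \<in> {f \<in> colourings_with w V m. constant_on_blocks P f}"
    show "?G (?F f) = f"
    proof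
      fix v
      show "?G (?F f) v = f v"
      proof (cases "v \<in> V")
        case True
        then have "f (SOME u. u \<in> blk v) = f v"
          using f blk[OF True] rep unfolding constant_on_blocks_def by blast
        with True show ?thesis by (simp add: blk)
      next
        case False
        with f show ?thesis by (auto simp: colourings_with_def)
      qed
    qed
  qed
  then show ?thesis by (rule bij_betw_same_card)
qed

lemma mcoeff_power_sums_type_of:
  assumes P: "partition_on V P" and fin: "finite V" and pos: "\<And>v. v \<in> V \<Longrightarrow> 0 < w v"
  shows "mcoeff (power_sums (type_of w P)) m =
    int (card {f \<in> colourings_with w V m. constant_on_blocks P f})"
proof -
  have finP: "finite P"
    using finite_elements[OF fin P] .
  \<comment> \<open>Blocks are nonempty and weights positive, so the power sum of index 0, whose
    defining family is not summable, never occurs.\<close>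
  have "0 < sum w S" if "S \<in> P" for S
  proof (rule sum_pos)
    show "finite S" "S \<noteq> {}" "\<And>v. v \<in> S \<Longrightarrow> 0 < w v"
      using that P fin pos by (auto simp: partition_on_def intro: finite_subset)
  qed
  then have "mcoeff (\<Prod>S\<in>P. power_sum (sum w S)) m = int (card (colourings_with (sum w) P m))"
    by (intro mcoeff_prod_power_sum finP)
  moreover have "power_sums (type_of w P) = (\<Prod>S\<in>P. power_sum (sum w S))"
    by (simp add: power_sums_def type_of_def prod_unfold_prod_mset multiset.map_comp comp_def)
  ultimately show ?thesis
    by (simp add: card_colourings_of_blocks[OF P fin])
qed

section \<open>Monochromatic components\<close>

definition mono_edges :: "'v graph \<Rightarrow> ('v \<Rightarrow> 'c) \<Rightarrow> ('v \<times> 'v) set"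
  where "mono_edges G \<kappa> = {(a, b). Upair a b \<in># edges G \<and> \<kappa> a = \<kappa> b}"

text \<open>The reflexive closure relates every element of the type to itself; the intersection cuts
  this down to an equivalence relation on the vertex set.\<close>

definition mono_rel :: "'v graph \<Rightarrow> ('v \<Rightarrow> 'c) \<Rightarrow> ('v \<times> 'v) set"
  where "mono_rel G \<kappa> = (mono_edges G \<kappa>)\<^sup>* \<inter> verts G \<times> verts G"

definition mono_components :: "'v graph \<Rightarrow> ('v \<Rightarrow> 'c) \<Rightarrow> 'v set set"
  where "mono_components G \<kappa> = verts G // mono_rel G \<kappa>"

lemma sym_mono_edges: "sym (mono_edges G \<kappa>)"
proof (rule symI)
  fix a b
  assume "(a, b) \<in> mono_edges G \<kappa>"
  moreover have "Upair a b = Upair b a" by simp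
  ultimately show "(b, a) \<in> mono_edges G \<kappa>"
    by (simp add: mono_edges_def)
qed

lemma equiv_mono_rel: "equiv (verts G) (mono_rel G \<kappa>)"
  unfolding mono_rel_def
proof (rule equivI)
  show "sym ((mono_edges G \<kappa>)\<^sup>* \<inter> verts G \<times> verts G)"
    using sym_rtrancl[OF sym_mono_edges[of G \<kappa>]] by (auto simp: sym_def)
qed (auto simp: refl_on_def intro!: transI intro: rtrancl_trans)

lemma mono_rel_constant: "(u, v) \<in> (mono_edges G \<kappa>)\<^sup>* \<Longrightarrow> \<kappa> u = \<kappa> v"
  by (induction rule: rtrancl_induct) (auto simp: mono_edges_def)

text \<open>A path of monochromatic edges never leaves the component of its starting point, so it is
  also a path in the restriction to that component.\<close>

lemma mono_components_in_contractions:
  assumes "finite_graph G"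
  shows "mono_components G \<kappa> \<in> contractions G"
proof -
  have part: "partition_on (verts G) (mono_components G \<kappa>)"
    unfolding mono_components_def by (rule partition_on_quotient[OF equiv_mono_rel])
  have "connected_graph (restriction G S)" if S: "S \<in> mono_components G \<kappa>" for S
    unfolding connected_graph_def
  proof (intro ballI)
    fix u v assume "u \<in> verts (restriction G S)" "v \<in> verts (restriction G S)"
    then have uv: "u \<in> S" "v \<in> S" by (auto simp: restriction_def)
    have "S = mono_rel G \<kappa> `` {u}"
      using S uv equiv_mono_rel[of G \<kappa>] unfolding mono_components_def
      by (metis Image_singleton_iff equiv_class_eq_iff quotientE)
    then have cls: "S = {x \<in> verts G. (u, x) \<in> (mono_edges G \<kappa>)\<^sup>*}" "u \<in> verts G"
      using uv by (auto simp: mono_rel_def)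
    have "(u, v) \<in> (mono_edges G \<kappa>)\<^sup>*"
      using cls uv by auto
    then show "(u, v) \<in> {(a, b). Upair a b \<in># edges (restriction G S)}\<^sup>*"
    proof (induction rule: rtrancl_induct)
      case (step y z)
      have e: "Upair y z \<in># edges G"
        using step.hyps by (simp add: mono_edges_def)
      then have "y \<in> verts G" "z \<in> verts G"
        using assms by (force simp: finite_graph_def)+
      \<comment> \<open>Both ends of the new edge are reachable from \<open>u\<close>, whose class
        is \<open>S\<close>; hence the edge survives the restriction.\<close>
      then have "y \<in> S" "z \<in> S"
        using step.hyps cls(1) by (auto intro: rtrancl_into_rtrancl)
      with e have "(y, z) \<in> {(a, b). Upair a b \<in># edges (restriction G S)}"
        by (simp add: restriction_def)
      with step.IH show ?case by (rule rtrancl_into_rtrancl)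
    qed simp
  qed
  with part show ?thesis by (simp add: contractions_def)
qed

text \<open>If a connected block has a single colour, all edges inside it are monochromatic, so it
  lies in one component. Conversely, colours do not change along monochromatic paths.\<close>

lemma constant_on_blocks_iff_le_mono_components:
  assumes "finite_graph G" and \<sigma>: "\<sigma> \<in> contractions G"
  shows "constant_on_blocks \<sigma> \<kappa> \<longleftrightarrow> (\<sigma>, mono_components G \<kappa>) \<in> contraction_order G"
proof
  assume const: "constant_on_blocks \<sigma> \<kappa>"
  have "\<exists>S\<in>mono_components G \<kappa>. T \<subseteq> S" if T: "T \<in> \<sigma>" for T
  proof -
    have TV: "T \<subseteq> verts G" and "T \<noteq> {}" and conn: "connected_graph (restriction G T)"
      using \<sigma> T by (auto simp: contractions_def partition_on_def)
    then obtain u where u: "u \<in> T" by auto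
    have "(u, v) \<in> mono_rel G \<kappa>" if v: "v \<in> T" for v
    proof -
      have "(u, v) \<in> {(a, b). Upair a b \<in># edges (restriction G T)}\<^sup>*"
        using conn u v TV by (auto simp: connected_graph_def restriction_def)
      moreover have "{(a, b). Upair a b \<in># edges (restriction G T)} \<subseteq> mono_edges G \<kappa>"
        using const T by (auto simp: restriction_def mono_edges_def constant_on_blocks_def)
      ultimately have "(u, v) \<in> (mono_edges G \<kappa>)\<^sup>*"
        using rtrancl_mono by blast
      with u v TV show ?thesis by (auto simp: mono_rel_def)
    qed
    then have "T \<subseteq> mono_rel G \<kappa> `` {u}" by auto
    moreover have "mono_rel G \<kappa> `` {u} \<in> mono_components G \<kappa>"
      using u TV by (auto simp: mono_components_def intro: quotientI)
    ultimately show ?thesis by blast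
  qed
  then show "(\<sigma>, mono_components G \<kappa>) \<in> contraction_order G"
    using \<sigma> mono_components_in_contractions[OF assms(1), of \<kappa>]
    by (auto simp: contraction_order_def refines_def contractions_def)
next
  assume le: "(\<sigma>, mono_components G \<kappa>) \<in> contraction_order G"
  show "constant_on_blocks \<sigma> \<kappa>"
    unfolding constant_on_blocks_def
  proof (intro ballI)
    fix T u v assume T: "T \<in> \<sigma>" "u \<in> T" "v \<in> T"
    then obtain S where "S \<in> mono_components G \<kappa>" "u \<in> S" "v \<in> S"
      using le by (auto simp: contraction_order_def refines_def) blast
    then have "(u, v) \<in> mono_rel G \<kappa>"
      using quotient_eq_iff[OF equiv_mono_rel] by (metis mono_components_def)
    then show "\<kappa> u = \<kappa> v"
      by (auto simp: mono_rel_def intro: mono_rel_constant)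
  qed
qed

text \<open>An edge with equally coloured ends puts both ends into one component. If all components
  are singletons, such an edge must be a loop, which \<open>loopless\<close> excludes.\<close>

lemma mono_components_eq_bottom_iff:
  assumes G: "finite_graph G" "loopless G" and \<kappa>: "\<kappa> \<in> verts G \<rightarrow>\<^sub>E {1..}"
  shows "mono_components G \<kappa> = bottom_contraction G \<longleftrightarrow> \<kappa> \<in> proper_colourings G"
proof
  assume eq: "mono_components G \<kappa> = bottom_contraction G"
  have "\<kappa> u \<noteq> \<kappa> v" if uv: "u \<in> verts G" "v \<in> verts G" "Upair u v \<in># edges G" for u v
  proof
    assume "\<kappa> u = \<kappa> v"
    with uv have "(u, v) \<in> mono_rel G \<kappa>"
      by (auto simp: mono_rel_def mono_edges_def)
    moreover have "(u, u) \<in> mono_rel G \<kappa>"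
      using uv by (simp add: mono_rel_def)
    moreover have "mono_rel G \<kappa> `` {u} \<in> bottom_contraction G"
      using uv eq by (auto simp: mono_components_def intro: quotientI)
    then obtain x where "mono_rel G \<kappa> `` {u} = {x}"
      by (auto simp: bottom_contraction_def)
    ultimately have "u \<in> {x}" "v \<in> {x}" by auto
    then have "u = v" by simp
    with uv G show False by (simp add: loopless_def)
  qed
  with \<kappa> show "\<kappa> \<in> proper_colourings G"
    by (simp add: proper_colourings_def)
next
  assume proper: "\<kappa> \<in> proper_colourings G"
  have "u \<in> verts G \<and> v \<in> verts G" if "Upair u v \<in># edges G" for u v
    using G(1) that by (force simp: finite_graph_def)
  with proper have "mono_edges G \<kappa> = {}"
    by (auto simp: mono_edges_def proper_colourings_def)
  then have "mono_rel G \<kappa> = Id_on (verts G)"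
    by (auto simp: mono_rel_def)
  then show "mono_components G \<kappa> = bottom_contraction G"
    by (auto simp: mono_components_def bottom_contraction_def quotient_def)
qed

section \<open>The expansion\<close>

text \<open>For \<open>x \<noteq> y\<close> this is the recursion for \<open>mobius r x y\<close>
  with its own term moved into the sum; for \<open>x = y\<close> antisymmetry shrinks the interval
  to a point.\<close>

lemma sum_mobius_interval:
  assumes "finite r" "Partial_order r" "(x, y) \<in> r"
  shows "(\<Sum>z | (x, z) \<in> r \<and> (z, y) \<in> r. mobius r x z) = (if x = y then 1 else 0)"
proof -
  have refl: "(x, x) \<in> r" "(y, y) \<in> r"
    using assms by (auto simp: partial_order_on_def preorder_on_def refl_on_def Field_def)
  show ?thesis
  proof (cases "x = y")
    case True
    then have "{z. (x, z) \<in> r \<and> (z, y) \<in> r} = {x}"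
      using assms refl by (auto dest: partial_order_onD(3) antisymD)
    with True show ?thesis
      using assms by (simp add: mobius.simps)
  next
    case False
    let ?I = "{z. (x, z) \<in> r \<and> (z, y) \<in> r \<and> z \<noteq> y}"
    have "finite ?I"
      by (rule finite_subset[of _ "Range r"]) (use assms in \<open>auto intro: finite_Range\<close>)
    moreover have "{z. (x, z) \<in> r \<and> (z, y) \<in> r} = insert y ?I"
      using assms refl by auto
    ultimately show ?thesis
      using assms False by (simp add: mobius.simps[of r x y])
  qed
qed

theorem proposition5p2:
  fixes G :: "'v graph" and w :: "'v \<Rightarrow> nat"
  assumes "weighted_graph G w"
    and "loopless G"
  shows "chromatic_function G w =
    (\<Sum>\<pi>\<in>contractions G.
      of_int (mobius (contraction_order G) (bottom_contraction G) \<pi>) * power_sums (type_of w \<pi>))"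
proof (rule mps_eqI)
  fix m
  let ?\<mu> = "mobius (contraction_order G) (bottom_contraction G)"
  \<comment> \<open>Comparing coefficients at one monomial replaces the possibly infinite set of all
    colourings by the finite set of those with monomial \<open>m\<close>, so that the order of
    summation can be exchanged.\<close>
  let ?C = "colourings_with w (verts G) m"
  have G: "finite_graph G" and fin: "finite (verts G)"
    and pos: "\<And>v. v \<in> verts G \<Longrightarrow> 0 < w v"
    using assms by (auto simp: weighted_graph_def finite_graph_def)
  have finC: "finite ?C"
    using fin pos by (rule finite_colourings_with)
  have inner: "(\<Sum>\<sigma>\<in>contractions G. if constant_on_blocks \<sigma> \<kappa> then ?\<mu> \<sigma> else 0) =
      (if \<kappa> \<in> proper_colourings G then 1 else 0)" if "\<kappa> \<in> ?C" for \<kappa>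
  proof -
    let ?\<pi> = "mono_components G \<kappa>"
    have "(\<Sum>\<sigma>\<in>contractions G. if constant_on_blocks \<sigma> \<kappa> then ?\<mu> \<sigma> else 0) =
        (\<Sum>\<sigma> | \<sigma> \<in> contractions G \<and> constant_on_blocks \<sigma> \<kappa>. ?\<mu> \<sigma>)"
      using finite_contractions[OF G] by (simp add: sum.inter_filter)
    \<comment> \<open>These contractions form the whole interval from the bottom element to
      \<open>?\<pi>\<close>, since the lower bound holds for every contraction.\<close>
    also have "{\<sigma>. \<sigma> \<in> contractions G \<and> constant_on_blocks \<sigma> \<kappa>} =
        {\<sigma>. (bottom_contraction G, \<sigma>) \<in> contraction_order G \<and> (\<sigma>, ?\<pi>) \<in> contraction_order G}"
      using constant_on_blocks_iff_le_mono_components[OF G] bottom_contraction_least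
      by (auto simp: contraction_order_def)
    also have "(\<Sum>\<sigma>\<in>\<dots>. ?\<mu> \<sigma>) = (if bottom_contraction G = ?\<pi> then 1 else 0)"
      by (intro sum_mobius_interval contraction_order_finite_poset G bottom_contraction_least
          mono_components_in_contractions)
    also have "\<dots> = (if \<kappa> \<in> proper_colourings G then 1 else 0)"
      using mono_components_eq_bottom_iff[OF G assms(2), of \<kappa>] that
      by (auto simp: colourings_with_def)
    finally show ?thesis .
  qed
  have "mcoeff (\<Sum>\<pi>\<in>contractions G. of_int (?\<mu> \<pi>) * power_sums (type_of w \<pi>)) m =
      (\<Sum>\<pi>\<in>contractions G. ?\<mu> \<pi> * int (card {\<kappa> \<in> ?C. constant_on_blocks \<pi> \<kappa>}))"
    unfolding mcoeff_sum mcoeff_of_int_mult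
    by (intro sum.cong refl)
       (simp add: contractions_def mcoeff_power_sums_type_of[OF _ fin pos])
  also have "\<dots> = (\<Sum>\<pi>\<in>contractions G. \<Sum>\<kappa>\<in>?C. if constant_on_blocks \<pi> \<kappa> then ?\<mu> \<pi> else 0)"
    using finC by (simp add: sum.inter_filter[symmetric] mult.commute)
  also have "\<dots> = (\<Sum>\<kappa>\<in>?C. \<Sum>\<pi>\<in>contractions G. if constant_on_blocks \<pi> \<kappa> then ?\<mu> \<pi> else 0)"
    by (rule sum.swap)
  also have "\<dots> = (\<Sum>\<kappa>\<in>?C. if \<kappa> \<in> proper_colourings G then 1 else 0)"
    by (intro sum.cong refl inner)
  also have "\<dots> = (\<Sum>\<kappa> | \<kappa> \<in> ?C \<and> \<kappa> \<in> proper_colourings G. 1)"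
    by (rule sum.inter_filter[OF finC, symmetric])
  \<comment> \<open>A colouring contributes 1 to the coefficient at \<open>m\<close> if its monomial
    is \<open>m\<close>, and 0 otherwise. The set thus becomes the index set that
    \<open>formal_sum\<close> uses at \<open>m\<close>, with all summands equal to 1.\<close>
  also have "{\<kappa>. \<kappa> \<in> ?C \<and> \<kappa> \<in> proper_colourings G} =
      {\<kappa>. \<kappa> \<in> proper_colourings G \<and> mcoeff (\<Prod>v\<in>verts G. mps_var (\<kappa> v) ^ w v :: int mps) m \<noteq> 0}"
    using fin by (auto simp: colourings_with_def proper_colourings_def mcoeff_prod_var_power)
  also have "(\<Sum>\<kappa>\<in>\<dots>. 1) = mcoeff (chromatic_function G w) m"
    unfolding chromatic_function_def formal_sum.rep_eq
    by (intro sum.cong refl) (use fin in \<open>auto simp: mcoeff_prod_var_power split: if_splits\<close>)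
  finally show "mcoeff (chromatic_function G w) m =
      mcoeff (\<Sum>\<pi>\<in>contractions G. of_int (?\<mu> \<pi>) * power_sums (type_of w \<pi>)) m"
    by simp
qed

end
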